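(* Let $\alpha>-1$, $t\ge0$ and let $n\ge2$ be an integer. The monic orthogonal polynomials with respect to the singularly perturbed Laguerre weight satisfy the mixed three-term recurrence relation $$x^2P_{n-2}(x;t,\alpha+2)=\left[\frac{e_n}{\beta_{n-1}(t,\alpha)}\left(x-\alpha_{n-1}(t,\alpha)\right)-d_n\right]P_{n-1}(x;t,\alpha)+\left(1-\frac{e_n}{\beta_{n-1}(t,\alpha)}\right)P_n(x;t,\alpha),$$ where $$d_n=\frac{P_n(0;t,\alpha)}{P_{n-1}(0;t,\alpha)}+\frac{P_{n-1}(0;t,\alpha+1)}{P_{n-2}(0;t,\alpha+1)},\qquad e_n=\frac{P_{n-1}(0;t,\alpha)}{P_{n-2}(0;t,\alpha)}\cdot\frac{P_{n-1}(0;t,\alpha+1)}{P_{n-2}(0;t,\alpha+1)}.$$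
   Context: For $\alpha>-1$, $t\ge0$, the singularly perturbed Laguerre weight is $w(x;t,\alpha)=x^\alpha e^{-x-t/x}$ on $(0,\infty)$. $P_n(x;t,\alpha)$, $n=0,1,2,\dots$, are the monic orthogonal polynomials of degree $n$ with respect to $w(\cdot;t,\alpha)$: $\int_0^\infty P_jP_kw\,dx=h_j\delta_{jk}$, $h_j>0$. The recurrence coefficients $\alpha_n(t,\alpha)$, $\beta_n(t,\alpha)$ are defined by $xP_n(x;t,\alpha)=P_{n+1}(x;t,\alpha)+\alpha_n(t,\alpha)P_n(x;t,\alpha)+\beta_n(t,\alpha)P_{n-1}(x;t,\alpha)$ with $P_0=1$, $\beta_0P_{-1}=0$. *)

theory Defs
  imports "HOL-Analysis.Analysis" "HOL-Computational_Algebra.Polynomial"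
begin

definition pLaguerre_weight :: "real \<Rightarrow> real \<Rightarrow> real \<Rightarrow> real" where
  "pLaguerre_weight t \<alpha> x = x powr \<alpha> * exp (- x - t / x)"

definition monic_orthogonal :: "(real \<Rightarrow> real) \<Rightarrow> (nat \<Rightarrow> real poly) \<Rightarrow> bool" where
  "monic_orthogonal w P \<longleftrightarrow>
     (\<forall>j. degree (P j) = j \<and> lead_coeff (P j) = 1) \<and>
     (\<exists>h. (\<forall>j. h j > 0) \<and>
          (\<forall>j k. (LBINT x:{0<..}. poly (P j) x * poly (P k) x * w x) = (if j = k then h j else 0)))"

definition pLaguerre :: "nat \<Rightarrow> real \<Rightarrow> real \<Rightarrow> real poly" where
  "pLaguerre n t \<alpha> = (THE P. monic_orthogonal (pLaguerre_weight t \<alpha>) P) n"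

(* The product b_0 * P_{-1} is 0 by convention; this is encoded by b 0 = 0, which makes the
   term for n = 0 vanish (there n - 1 = 0) and makes the sequence b unique. *)
definition three_term_recurrence ::
    "(nat \<Rightarrow> real poly) \<Rightarrow> (nat \<Rightarrow> real) \<Rightarrow> (nat \<Rightarrow> real) \<Rightarrow> bool" where
  "three_term_recurrence P a b \<longleftrightarrow>
     b 0 = 0 \<and>
     (\<forall>n. [:0, 1:] * P n = P (n + 1) + smult (a n) (P n) + smult (b n) (P (n - 1)))"

definition rec_alpha :: "nat \<Rightarrow> real \<Rightarrow> real \<Rightarrow> real" where
  "rec_alpha n t \<alpha> = (THE a. \<exists>b. three_term_recurrence (\<lambda>m. pLaguerre m t \<alpha>) a b) n"

definition rec_beta :: "nat \<Rightarrow> real \<Rightarrow> real \<Rightarrow> real" where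
  "rec_beta n t \<alpha> = (THE b. \<exists>a. three_term_recurrence (\<lambda>m. pLaguerre m t \<alpha>) a b) n"

definition d_coeff :: "nat \<Rightarrow> real \<Rightarrow> real \<Rightarrow> real" where
  "d_coeff n t \<alpha> =
     poly (pLaguerre n t \<alpha>) 0 / poly (pLaguerre (n - 1) t \<alpha>) 0
     + poly (pLaguerre (n - 1) t (\<alpha> + 1)) 0 / poly (pLaguerre (n - 2) t (\<alpha> + 1)) 0"

definition e_coeff :: "nat \<Rightarrow> real \<Rightarrow> real \<Rightarrow> real" where
  "e_coeff n t \<alpha> =
     (poly (pLaguerre (n - 1) t \<alpha>) 0 / poly (pLaguerre (n - 2) t \<alpha>) 0)
     * (poly (pLaguerre (n - 1) t (\<alpha> + 1)) 0 / poly (pLaguerre (n - 2) t (\<alpha> + 1)) 0)"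

end

theory Submission
  imports Defs
begin

text \<open>Since \<open>w(x;t,\<alpha>+1) = x w(x;t,\<alpha>)\<close>, Christoffel's formula gives
  \<open>x P\<^sub>m(x;\<alpha>+1) = P\<^sub>m\<^sub>+\<^sub>1(x;\<alpha>) - r P\<^sub>m(x;\<alpha>)\<close> with \<open>r = P\<^sub>m\<^sub>+\<^sub>1(0;\<alpha>) / P\<^sub>m(0;\<alpha>)\<close>. Applying it
  at \<open>\<alpha>+1\<close> and then twice at \<open>\<alpha>\<close> yields
  \<open>x\<^sup>2 P\<^sub>n\<^sub>-\<^sub>2(x;\<alpha>+2) = P\<^sub>n - d\<^sub>n P\<^sub>n\<^sub>-\<^sub>1 + e\<^sub>n P\<^sub>n\<^sub>-\<^sub>2\<close>, and the three-term recurrence eliminates \<open>P\<^sub>n\<^sub>-\<^sub>2\<close>.\<close>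

section \<open>Moments of polynomials against a positive weight\<close>

definition moment :: "(real \<Rightarrow> real) \<Rightarrow> real poly \<Rightarrow> real" where
  "moment w p = (LBINT x:{0<..}. poly p x * w x)"

text \<open>Positivity and finite moments suffice for the whole orthogonality theory, so it is
  available at the parameters \<open>\<alpha>\<close>, \<open>\<alpha> + 1\<close> and
  \<open>\<alpha> + 2\<close> alike.\<close>

locale positive_weight =
  fixes w :: "real \<Rightarrow> real"
  assumes weight_pos: "x > 0 \<Longrightarrow> w x > 0"
    and integrable_power: "set_integrable lborel {0<..} (\<lambda>x. x ^ k * w x)"
begin

lemma integrable_poly: "set_integrable lborel {0<..} (\<lambda>x. poly p x * w x)"
proof -
  have "set_integrable lborel {0<..} (\<lambda>x. \<Sum>i\<le>degree p. coeff p i * (x ^ i * w x))"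
    using integrable_power unfolding set_integrable_def scaleR_sum_right
    by (intro Bochner_Integration.integrable_sum) (simp add: mult.left_commute)
  then show ?thesis
    by (simp add: poly_altdef sum_distrib_right mult.assoc)
qed

lemma moment_add: "moment w (p + q) = moment w p + moment w q"
  unfolding moment_def
  by (simp add: distrib_right set_integral_add(2) integrable_poly)

lemma moment_smult: "moment w (smult c p) = c * moment w p"
  unfolding moment_def by (simp add: mult.assoc)

lemma moment_diff: "moment w (p - q) = moment w p - moment w q"
  using moment_add[of "p - q" q] by simp

lemma moment_0: "moment w 0 = 0"
  by (simp add: moment_def)

lemmas moment_simps = moment_add moment_diff moment_smult moment_0

text \<open>A zero integral of a nonnegative integrand would make it vanish almost everywhere; the
  weight is positive and \<open>p\<close> has finitely many roots, so even (0,1) would be a null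
  set.\<close>

lemma moment_pos:
  assumes "p \<noteq> 0" and nonneg: "\<And>x. x > 0 \<Longrightarrow> poly p x \<ge> 0"
  shows "moment w p > 0"
proof -
  let ?f = "\<lambda>x. indicator {0<..} x *\<^sub>R (poly p x * w x)"
  have int: "integrable lborel ?f"
    using integrable_poly[of p] by (simp add: set_integrable_def)
  have f0: "0 \<le> ?f x" for x
    using nonneg[of x] weight_pos[of x] by (auto simp: indicator_def)
  have "moment w p \<noteq> 0"
  proof
    assume "moment w p = 0"
    then have "AE x in lborel. ?f x = 0"
      using integral_nonneg_eq_0_iff_AE[OF int] f0
      by (simp add: moment_def set_lebesgue_integral_def)
    moreover have "AE x in lborel. x \<notin> {x. poly p x = 0}"
      using poly_roots_finite[OF \<open>p \<noteq> 0\<close>]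
      by (intro AE_not_in finite_imp_null_set_lborel)
    ultimately have "AE x in lborel. x \<notin> {0<..<1::real}"
    proof eventually_elim
      case (elim x)
      then show ?case
        using weight_pos[of x] by (auto simp: indicator_def split: if_splits)
    qed
    then have "emeasure lborel {0<..<1::real} = 0"
      by (subst (asm) AE_iff_null_sets[symmetric]) auto
    then show False by simp
  qed
  moreover have "moment w p \<ge> 0"
    unfolding moment_def set_lebesgue_integral_def
    by (intro Bochner_Integration.integral_nonneg f0)
  ultimately show ?thesis by simp
qed

lemma moment_square_pos: "p \<noteq> 0 \<Longrightarrow> moment w (p * p) > 0"
  by (rule moment_pos) auto

lemma moment_X_square_pos: "p \<noteq> 0 \<Longrightarrow> moment w ([:0, 1:] * (p * p)) > 0"
  by (rule moment_pos) (auto simp: mult_nonneg_nonneg)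

text \<open>The positive norms \<open>h\<close> come for free: monic polynomials are nonzero, so
  their squares have positive moment.\<close>

lemma monic_orthogonal_iff:
  "monic_orthogonal w P \<longleftrightarrow>
     (\<forall>j. degree (P j) = j \<and> lead_coeff (P j) = 1) \<and>
     (\<forall>j k. j \<noteq> k \<longrightarrow> moment w (P j * P k) = 0)" (is "_ \<longleftrightarrow> ?D \<and> ?O")
proof
  assume P: "monic_orthogonal w P"
  then have ?D unfolding monic_orthogonal_def by (rule conjunct1)
  moreover from P have ?O by (auto simp: monic_orthogonal_def moment_def)
  ultimately show "?D \<and> ?O" by (rule conjI)
next
  assume DO: "?D \<and> ?O"
  then have "P j \<noteq> 0" for j by (metis coeff_0 zero_neq_one)
  then have "moment w (P j * P j) > 0" for j by (rule moment_square_pos)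
  with conjunct2[OF DO] show "monic_orthogonal w P"
    unfolding monic_orthogonal_def
    by (intro conjI[OF conjunct1[OF DO]] exI[of _ "\<lambda>j. moment w (P j * P j)"])
      (simp add: moment_def)
qed

section \<open>Consequences of orthogonality: nonvanishing at 0, Christoffel's formula,
  uniqueness\<close>

context
  fixes P
  assumes P: "monic_orthogonal w P"
begin

lemma degree_orthogonal: "degree (P n) = n"
  and coeff_orthogonal: "coeff (P n) n = 1"
proof -
  have "degree (P n) = n \<and> lead_coeff (P n) = 1"
    using P unfolding monic_orthogonal_iff by blast
  then show "degree (P n) = n" "coeff (P n) n = 1" by metis+
qed

lemma coeff_orthogonal_eq_0: "n < i \<Longrightarrow> coeff (P n) i = 0"
  by (simp add: coeff_eq_0 degree_orthogonal)

lemma orthogonal_nonzero: "P n \<noteq> 0"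
  using coeff_orthogonal[of n] by auto

text \<open>Subtracting a multiple of \<open>P m\<close> removes the top coefficient of
  \<open>q\<close>. The strict degree bound \<open>m\<close> lets the induction start at the zero
  polynomial.\<close>

lemma orthogonal_lower:
  assumes "\<And>i. i \<ge> m \<Longrightarrow> coeff q i = 0" and "m \<le> n"
  shows "moment w (P n * q) = 0"
  using assms
proof (induction m arbitrary: q)
  case 0
  then have "q = 0" by (intro poly_eqI) simp
  then show ?case by (simp add: moment_0)
next
  case (Suc m)
  define r where "r = q - smult (coeff q m) (P m)"
  have "coeff r i = 0" if "i \<ge> m" for i
    using that Suc.prems(1)[of i]
    by (cases "i = m") (auto simp: r_def coeff_orthogonal coeff_orthogonal_eq_0)
  then have "moment w (P n * r) = 0"
    using Suc by auto
  moreover have "moment w (P n * P m) = 0"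
    using P Suc.prems(2) by (auto simp: monic_orthogonal_iff)
  ultimately show ?case
    by (simp add: r_def right_diff_distrib moment_simps)
qed

text \<open>A root at 0 would give \<open>P n\<close> = x q with deg q < n; then orthogonality to q
  contradicts the positivity of the moment of x q^2 on the half-line. All quotients of values at 0
  thus have nonzero denominators.\<close>

lemma orthogonal_at_0: "poly (P n) 0 \<noteq> 0"
proof
  assume "poly (P n) 0 = 0"
  then obtain q where q: "P n = [:0, 1:] * q"
    by (metis poly_eq_0_iff_dvd dvdE neg_0_equal_iff_equal)
  then have Pn: "P n = pCons 0 q" by simp
  have "coeff q i = 0" if "i \<ge> n" for i
    using coeff_orthogonal_eq_0[of n "Suc i"] that by (simp add: Pn)
  then have "moment w (P n * q) = 0"
    by (rule orthogonal_lower) auto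
  moreover have "q \<noteq> 0" using q orthogonal_nonzero[of n] by auto
  ultimately show False
    using moment_X_square_pos[of q] by (simp add: q mult.assoc)
qed

text \<open>The right-hand side vanishes at 0, so it is x S. Since \<open>v\<close> is x times
  \<open>w\<close>, S inherits orthogonality to lower degrees under \<open>v\<close>; being monic of
  degree \<open>n\<close>, it must be \<open>Q n\<close>.\<close>

lemma christoffel_formula:
  assumes Q: "monic_orthogonal v Q" and v: "positive_weight v"
    and vw: "\<And>x. x > 0 \<Longrightarrow> v x = x * w x"
  shows "[:0, 1:] * Q n = P (Suc n) - smult (poly (P (Suc n)) 0 / poly (P n) 0) (P n)"
proof -
  interpret v: positive_weight v by (fact v)
  have vw': "moment v p = moment w ([:0, 1:] * p)" for p
    unfolding moment_def by (intro set_lebesgue_integral_cong) (auto simp: vw)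
  define R where "R = P (Suc n) - smult (poly (P (Suc n)) 0 / poly (P n) 0) (P n)"
  have "poly R 0 = 0" by (simp add: R_def orthogonal_at_0)
  then obtain S where S: "R = [:0, 1:] * S"
    by (metis poly_eq_0_iff_dvd dvdE neg_0_equal_iff_equal)
  define E where "E = Q n - S"
  have coeff_S: "coeff S i = coeff R (Suc i)" for i by (simp add: S)
  \<comment> \<open>At \<open>i = n\<close> the leading coefficients of \<open>Q n\<close> and
    \<open>S\<close>, both 1, cancel.\<close>
  have E: "coeff E i = 0" if "i \<ge> n" for i
    using that
    by (cases "i = n")
      (auto simp: E_def coeff_S R_def coeff_orthogonal coeff_orthogonal_eq_0
        v.coeff_orthogonal[OF Q] v.coeff_orthogonal_eq_0[OF Q])
  have "moment w (R * E) = 0"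
    unfolding R_def left_diff_distrib moment_simps mult_smult_left
    using orthogonal_lower[OF E, of n] orthogonal_lower[OF E, of "Suc n"] by simp
  then have "moment v (S * E) = 0"
    by (simp only: vw' S mult.assoc)
  moreover have "moment v (Q n * E) = 0"
    by (rule v.orthogonal_lower[OF Q E order_refl])
  ultimately have "moment v (E * E) = 0"
    by (simp add: E_def left_diff_distrib v.moment_diff)
  then have "E = 0" using v.moment_square_pos[of E] by force
  then show ?thesis by (simp add: E_def R_def[symmetric] S)
qed

end

text \<open>The difference of the two polynomials has degree below \<open>n\<close>, so it is
  orthogonal to both and hence to itself.\<close>

lemma monic_orthogonal_unique:
  assumes P: "monic_orthogonal w P" and Q: "monic_orthogonal w Q"
  shows "P = Q"
proof
  fix n
  have D: "coeff (P n - Q n) i = 0" if "i \<ge> n" for i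
    using that
    by (cases "i = n") (auto simp: P Q coeff_orthogonal coeff_orthogonal_eq_0)
  have "moment w (P n * (P n - Q n)) = 0" "moment w (Q n * (P n - Q n)) = 0"
    using orthogonal_lower[OF P D] orthogonal_lower[OF Q D] by auto
  then have "moment w ((P n - Q n) * (P n - Q n)) = 0"
    by (simp only: left_diff_distrib[of "P n" "Q n"] moment_diff)
  then show "P n = Q n"
    using moment_square_pos[of "P n - Q n"] by force
qed

end

text \<open>Building the polynomials from their recurrence (Stieltjes' procedure) instead of by
  Gram--Schmidt yields orthogonality and the recurrence at the same time.\<close>

fun stieltjes :: "(real \<Rightarrow> real) \<Rightarrow> nat \<Rightarrow> real poly" where
  "stieltjes w 0 = 1"
| "stieltjes w (Suc 0) = [:0, 1:] - [:moment w [:0, 1:] / moment w 1:]"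
| "stieltjes w (Suc (Suc n)) =
     (let p = stieltjes w n; q = stieltjes w (Suc n)
      in [:0, 1:] * q - smult (moment w ([:0, 1:] * (q * q)) / moment w (q * q)) q
         - smult (moment w (q * q) / moment w (p * p)) p)"

definition stieltjes_a :: "(real \<Rightarrow> real) \<Rightarrow> nat \<Rightarrow> real" where
  "stieltjes_a w n = moment w ([:0, 1:] * (stieltjes w n * stieltjes w n))
                     / moment w (stieltjes w n * stieltjes w n)"

definition stieltjes_b :: "(real \<Rightarrow> real) \<Rightarrow> nat \<Rightarrow> real" where
  "stieltjes_b w n = (if n = 0 then 0 else moment w (stieltjes w n * stieltjes w n)
                     / moment w (stieltjes w (n - 1) * stieltjes w (n - 1)))"

text \<open>Also valid at \<open>n = 0\<close>, where \<open>n - 1\<close> truncates to 0 but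
  \<open>stieltjes_b w 0 = 0\<close> removes the term.\<close>

lemma stieltjes_Suc:
  "stieltjes w (Suc n) = [:0, 1:] * stieltjes w n - smult (stieltjes_a w n) (stieltjes w n)
     - smult (stieltjes_b w n) (stieltjes w (n - 1))"
  by (cases n) (simp_all add: stieltjes_a_def stieltjes_b_def Let_def)

lemma three_term_recurrence_stieltjes:
  "three_term_recurrence (stieltjes w) (stieltjes_a w) (stieltjes_b w)"
  unfolding three_term_recurrence_def
  by (auto simp: stieltjes_Suc stieltjes_b_def)

lemma coeff_stieltjes: "coeff (stieltjes w n) n = 1 \<and> (\<forall>i>n. coeff (stieltjes w n) i = 0)"
proof (induction n rule: less_induct)
  case (less n)
  show ?case
  proof (cases n)
    case 0
    then show ?thesis by auto
  next
    case (Suc m)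
    have "coeff (stieltjes w m) m = 1" "\<And>i. i > m \<Longrightarrow> coeff (stieltjes w m) i = 0"
      "\<And>i. i > m \<Longrightarrow> coeff (stieltjes w (m - 1)) i = 0"
      using less[of m] less[of "m - 1"] Suc by auto
    then show ?thesis
      by (auto simp: Suc stieltjes_Suc coeff_pCons split: nat.split)
  qed
qed

lemma degree_stieltjes: "degree (stieltjes w n) = n"
  using coeff_stieltjes[of w n] by (intro antisym degree_le le_degree) auto

lemma stieltjes_nonzero: "stieltjes w n \<noteq> 0"
  using coeff_stieltjes[of w n] by auto

context positive_weight
begin

text \<open>Multiplication by x is symmetric for the moment pairing, so it can be moved to the lower
  polynomial and expanded there. The choice of \<open>stieltjes_a\<close> settles
  \<open>j = m\<close>, that of \<open>stieltjes_b\<close> settles \<open>j = m - 1\<close>; below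
  that every term vanishes.\<close>

lemma stieltjes_orthogonal: "j < n \<Longrightarrow> moment w (stieltjes w n * stieltjes w j) = 0"
proof (induction n arbitrary: j rule: less_induct)
  case (less n)
  let ?S = "stieltjes w" and ?a = "stieltjes_a w" and ?b = "stieltjes_b w"
  obtain m where n: "n = Suc m" using less.prems by (cases n) auto
  have orth: "moment w (?S i * ?S k) = 0" if "i \<noteq> k" "i \<le> m" "k \<le> m" for i k
    using that less.IH[of i k] less.IH[of k i] n
    by (cases "i < k") (auto simp: mult.commute)
  have sq: "moment w (?S i * ?S i) \<noteq> 0" for i
    using moment_square_pos[OF stieltjes_nonzero[of w i]] by simp
  have b: "?b m * moment w (?S (m - 1) * ?S j) = (if Suc j = m then moment w (?S m * ?S m) else 0)"
    if "j < m"
    using that sq[of j] orth[of "m - 1" j] by (auto simp: stieltjes_b_def)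
  have step: "moment w (?S n * ?S j) = moment w ([:0, 1:] * (?S m * ?S j))
      - ?a m * moment w (?S m * ?S j) - ?b m * moment w (?S (m - 1) * ?S j)"
    unfolding n stieltjes_Suc[of w m]
    by (simp only: left_diff_distrib moment_diff mult_smult_left moment_smult mult.assoc)
  show ?case
  proof (cases "j = m")
    case True
    \<comment> \<open>For \<open>m = 0\<close> both factors are \<open>stieltjes w 0\<close> and not
      orthogonal; there \<open>?b 0 = 0\<close> helps.\<close>
    have "?b m * moment w (?S (m - 1) * ?S m) = 0"
      using orth[of "m - 1" m] by (cases m) (auto simp: stieltjes_b_def)
    then show ?thesis
      using sq[of m] step by (simp add: True stieltjes_a_def)
  next
    case False
    then have j: "j < m" using less.prems n by simp
    have "[:0, 1:] * (?S m * ?S j) = ?S m * ([:0, 1:] * ?S j)" by (simp only: ac_simps)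
    also have "[:0, 1:] * ?S j = ?S (Suc j) + smult (?a j) (?S j) + smult (?b j) (?S (j - 1))"
      unfolding stieltjes_Suc[of w j] by simp
    finally have "moment w ([:0, 1:] * (?S m * ?S j)) = moment w (?S m * ?S (Suc j))
        + ?a j * moment w (?S m * ?S j) + ?b j * moment w (?S m * ?S (j - 1))"
      by (simp only: distrib_left moment_add mult_smult_right moment_smult)
    then show ?thesis
      using j orth[of m j] orth[of m "j - 1"] orth[of m "Suc j"] b[OF j] step by auto
  qed
qed

lemma monic_orthogonal_stieltjes: "monic_orthogonal w (stieltjes w)"
  unfolding monic_orthogonal_iff
proof (intro conjI allI impI)
  fix j k :: nat
  assume "j \<noteq> k"
  then show "moment w (stieltjes w j * stieltjes w k) = 0"
    using stieltjes_orthogonal[of j k] stieltjes_orthogonal[of k j]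
    by (cases "j < k") (auto simp: mult.commute)
qed (simp_all add: degree_stieltjes coeff_stieltjes)

lemma the_monic_orthogonal: "(THE P. monic_orthogonal w P) = stieltjes w"
  using monic_orthogonal_stieltjes monic_orthogonal_unique by blast

text \<open>Permits solving the recurrence for its lowest-index polynomial.\<close>

lemma stieltjes_b_pos: "n > 0 \<Longrightarrow> stieltjes_b w n > 0"
  using moment_square_pos[OF stieltjes_nonzero] by (simp add: stieltjes_b_def)

end

text \<open>Subtracting the recurrences equates a multiple of \<open>P n\<close> with one of
  \<open>P (n - 1)\<close>; the coefficient of degree \<open>n\<close> then separates them.\<close>

lemma three_term_recurrence_unique:
  assumes deg: "\<And>n. degree (P n) = n" and nz: "\<And>n. P n \<noteq> 0"
    and 1: "three_term_recurrence P a b" and 2: "three_term_recurrence P a' b'"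
  shows "a = a' \<and> b = b'"
proof -
  have "a n = a' n \<and> b n = b' n" for n
  proof -
    have b0: "b 0 = 0" "b' 0 = 0"
      using 1 2 by (auto simp: three_term_recurrence_def)
    have "[:0, 1:] * P n = P (n + 1) + smult (a n) (P n) + smult (b n) (P (n - 1))"
      "[:0, 1:] * P n = P (n + 1) + smult (a' n) (P n) + smult (b' n) (P (n - 1))"
      using 1 2 unfolding three_term_recurrence_def by blast+
    then have eq: "smult (a n - a' n) (P n) = smult (b' n - b n) (P (n - 1))"
      by (simp add: smult_diff_left algebra_simps)
    have "coeff (smult (a n - a' n) (P n)) n = 0"
      \<comment> \<open>At \<open>n = 0\<close> the degrees do not differ, but
        \<open>b 0 = b' 0 = 0\<close> makes the right side zero.\<close>
      unfolding eq using b0 by (cases n) (simp_all add: coeff_eq_0 deg)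
    moreover have "coeff (P n) n \<noteq> 0"
      using nz[of n] deg[of n] by (metis leading_coeff_0_iff)
    ultimately have a: "a n = a' n" by simp
    then have "b n = b' n" using eq nz[of "n - 1"] by simp
    with a show ?thesis by simp
  qed
  then show ?thesis by auto
qed

section \<open>The singularly perturbed Laguerre weight\<close>

text \<open>As exp(-t/x) is at most 1, each power moment is dominated by the Gamma integral at
  \<open>\<alpha> + k + 1 > 0\<close>.\<close>

lemma positive_weight_pLaguerre:
  assumes "\<alpha> > -1" and "t \<ge> 0"
  shows "positive_weight (pLaguerre_weight t \<alpha>)"
proof
  fix x :: real
  assume "x > 0"
  then show "pLaguerre_weight t \<alpha> x > 0" by (simp add: pLaguerre_weight_def)
next
  fix k :: nat
  let ?g = "\<lambda>x::real. x powr (\<alpha> + k) / exp x"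
  have "?g absolutely_integrable_on {0..}"
    using Gamma_integral_real[of "\<alpha> + k + 1"] assms
    by (intro nonnegative_absolutely_integrable_1) (auto intro: has_integral_integrable)
  \<comment> \<open>Absolute integrability refers to the completed measure; Borel measurability of
    \<open>?g\<close> transfers it to \<open>lborel\<close>.\<close>
  then have "set_integrable lborel {0..} ?g"
    unfolding set_integrable_def by (subst (asm) integrable_completion) auto
  then have g: "set_integrable lborel {0<..} ?g"
    by (rule set_integrable_subset) auto
  show "set_integrable lborel {0<..} (\<lambda>x. x ^ k * pLaguerre_weight t \<alpha> x)"
  proof (rule set_integrable_bound[OF g])
    show "set_borel_measurable lborel {0<..} (\<lambda>x. x ^ k * pLaguerre_weight t \<alpha> x)"
      unfolding set_borel_measurable_def pLaguerre_weight_def by measurable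
    have "norm (x ^ k * pLaguerre_weight t \<alpha> x) \<le> norm (?g x)" if "x > 0" for x
    proof -
      have "x ^ k * pLaguerre_weight t \<alpha> x = x powr (\<alpha> + k) * exp (- x - t / x)"
        using that by (simp add: pLaguerre_weight_def powr_add powr_realpow)
      also have "\<dots> \<le> x powr (\<alpha> + k) * exp (- x)"
        using that assms by (intro mult_left_mono) auto
      finally show ?thesis
        using that by (simp add: exp_minus divide_inverse pLaguerre_weight_def)
    qed
    then show "AE x in lborel. x \<in> {0<..} \<longrightarrow> norm (x ^ k * pLaguerre_weight t \<alpha> x) \<le> norm (?g x)"
      by simp
  qed
qed

lemma pLaguerre_eq_stieltjes:
  assumes "\<alpha> > -1" and "t \<ge> 0"
  shows "pLaguerre n t \<alpha> = stieltjes (pLaguerre_weight t \<alpha>) n"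
  using positive_weight.the_monic_orthogonal[OF positive_weight_pLaguerre[OF assms]]
  by (simp add: pLaguerre_def)

lemma monic_orthogonal_pLaguerre:
  assumes "\<alpha> > -1" and "t \<ge> 0"
  shows "monic_orthogonal (pLaguerre_weight t \<alpha>) (\<lambda>n. pLaguerre n t \<alpha>)"
  using positive_weight.monic_orthogonal_stieltjes[OF positive_weight_pLaguerre[OF assms]]
  by (simp add: pLaguerre_eq_stieltjes assms)

lemma rec_coeffs_eq_stieltjes:
  assumes "\<alpha> > -1" and "t \<ge> 0"
  shows "rec_alpha n t \<alpha> = stieltjes_a (pLaguerre_weight t \<alpha>) n"
    and "rec_beta n t \<alpha> = stieltjes_b (pLaguerre_weight t \<alpha>) n"
proof -
  let ?w = "pLaguerre_weight t \<alpha>"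
  have P: "(\<lambda>m. pLaguerre m t \<alpha>) = stieltjes ?w"
    by (simp add: pLaguerre_eq_stieltjes assms)
  note ttr = three_term_recurrence_stieltjes[of ?w]
  note unique = three_term_recurrence_unique[OF degree_stieltjes stieltjes_nonzero _ ttr]
  have "(THE a. \<exists>b. three_term_recurrence (stieltjes ?w) a b) = stieltjes_a ?w"
    using ttr unique by (intro the_equality) blast+
  then show "rec_alpha n t \<alpha> = stieltjes_a ?w n" by (simp add: rec_alpha_def P)
  have "(THE b. \<exists>a. three_term_recurrence (stieltjes ?w) a b) = stieltjes_b ?w"
    using ttr unique by (intro the_equality) blast+
  then show "rec_beta n t \<alpha> = stieltjes_b ?w n" by (simp add: rec_beta_def P)
qed

lemma pLaguerre_recurrence:
  assumes "\<alpha> > -1" and "t \<ge> 0"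
  shows "pLaguerre (Suc n) t \<alpha> = [:0, 1:] * pLaguerre n t \<alpha>
    - smult (rec_alpha n t \<alpha>) (pLaguerre n t \<alpha>) - smult (rec_beta n t \<alpha>) (pLaguerre (n - 1) t \<alpha>)"
  by (simp only: pLaguerre_eq_stieltjes rec_coeffs_eq_stieltjes assms stieltjes_Suc)

lemma pLaguerre_christoffel:
  assumes "\<alpha> > -1" and "t \<ge> 0"
  shows "x * poly (pLaguerre n t (\<alpha> + 1)) x = poly (pLaguerre (Suc n) t \<alpha>) x
    - poly (pLaguerre (Suc n) t \<alpha>) 0 / poly (pLaguerre n t \<alpha>) 0 * poly (pLaguerre n t \<alpha>) x"
proof -
  have "[:0, 1:] * pLaguerre n t (\<alpha> + 1) = pLaguerre (Suc n) t \<alpha>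
    - smult (poly (pLaguerre (Suc n) t \<alpha>) 0 / poly (pLaguerre n t \<alpha>) 0) (pLaguerre n t \<alpha>)"
    using assms
    by (intro positive_weight.christoffel_formula[where w = "pLaguerre_weight t \<alpha>"
          and v = "pLaguerre_weight t (\<alpha> + 1)"] positive_weight_pLaguerre monic_orthogonal_pLaguerre)
      (auto simp: pLaguerre_weight_def powr_add)
  from arg_cong[OF this, of "\<lambda>p. poly p x"] show ?thesis by simp
qed

theorem lemma3p1:
  fixes \<alpha> t x :: real and n :: nat
  assumes "\<alpha> > -1" and "t \<ge> 0" and "n \<ge> 2"
  shows "x ^ 2 * poly (pLaguerre (n - 2) t (\<alpha> + 2)) x =
    (e_coeff n t \<alpha> / rec_beta (n - 1) t \<alpha> * (x - rec_alpha (n - 1) t \<alpha>) - d_coeff n t \<alpha>)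
      * poly (pLaguerre (n - 1) t \<alpha>) x
    + (1 - e_coeff n t \<alpha> / rec_beta (n - 1) t \<alpha>) * poly (pLaguerre n t \<alpha>) x"
proof -
  obtain m where n: "n = Suc (Suc m)"
    using \<open>n \<ge> 2\<close> by (metis Suc_le_D add_2_eq_Suc le_Suc_ex)
  let ?p = "\<lambda>k. poly (pLaguerre k t \<alpha>) x" and ?q = "\<lambda>k. poly (pLaguerre k t (\<alpha> + 1)) x"
  define b where "b = rec_beta (Suc m) t \<alpha>"
  \<comment> \<open>With \<open>n = m + 2\<close>, d_n is \<open>r (Suc m) + s\<close> and e_n is
    \<open>r m * s\<close>.\<close>
  define r where "r k = poly (pLaguerre (Suc k) t \<alpha>) 0 / poly (pLaguerre k t \<alpha>) 0" for k
  define s where "s = poly (pLaguerre (Suc m) t (\<alpha> + 1)) 0 / poly (pLaguerre m t (\<alpha> + 1)) 0"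
  have b: "b > 0"
    using positive_weight.stieltjes_b_pos[OF positive_weight_pLaguerre, of \<alpha> t "Suc m"] assms
    by (simp add: b_def rec_coeffs_eq_stieltjes)
  have q: "x * ?q k = ?p (Suc k) - r k * ?p k" for k
    using pLaguerre_christoffel[of \<alpha> t x k] assms by (simp add: r_def)
  have "x ^ 2 * poly (pLaguerre m t (\<alpha> + 2)) x = x * (?q (Suc m) - s * ?q m)"
    using pLaguerre_christoffel[of "\<alpha> + 1" t x m] assms
    by (simp add: s_def power2_eq_square add.assoc mult.assoc)
  also have "\<dots> = x * ?q (Suc m) - s * (x * ?q m)"
    by (simp add: algebra_simps)
  also have "\<dots> = ?p n - (r (Suc m) + s) * ?p (Suc m) + r m * s * ?p m"
    by (simp only: q n) (simp add: algebra_simps)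
  \<comment> \<open>The recurrence at index n-1, solved for P_{n-2}.\<close>
  also have "?p m = ((x - rec_alpha (Suc m) t \<alpha>) * ?p (Suc m) - ?p n) / b"
    using b arg_cong[OF pLaguerre_recurrence[of \<alpha> t "Suc m"], of "\<lambda>p. poly p x"] assms
    by (simp add: n b_def field_simps)
  finally have "x ^ 2 * poly (pLaguerre m t (\<alpha> + 2)) x = (r m * s / b * (x - rec_alpha (Suc m) t \<alpha>)
      - (r (Suc m) + s)) * ?p (Suc m) + (1 - r m * s / b) * ?p n"
    by (simp add: algebra_simps add_divide_distrib diff_divide_distrib)
  then show ?thesis
    by (simp add: n d_coeff_def e_coeff_def b_def r_def s_def)
qed

end
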